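(* Let $R$ be a commutative $\mathbb{Q}$-algebra. For every $t\in\Omega_R$, the operation $\boxplus^{H}_{t}$ on $HR$ is bilinear (over $R$), commutative, and associative, with identity $h_1$. Moreover, the map $\Phi_t^H:(HR,\boxplus^H_t)\to R[[z]]$ is an algebra isomorphism, so that in particular $$\Phi_t^H(f\boxplus^{H}_{t}g)=\Phi_t^H(f)\,\Phi_t^H(g)\qquad (f,g\in HR).$$ At $t=-1$, the operation $\boxplus^{H}_{-1}$ is the ordinary Hurwitz product on $HR$, i.e. $(f\boxplus^H_{-1}g)(n)=\sum_{k=0}^n\binom{n}{k}f(k)g(n-k)$ for all $n\in\mathbb{N}$.
   Context: $\mathbb{N}=\{0,1,2,\dots\}$. $HR$ is the set of all maps $f:\mathbb{N}\to R$, with componentwise addition and $R$-scalar multiplication; the ordinary Hurwitz product is $(fg)(n)=\sum_{k=0}^n\binom nk f(k)g(n-k)$. The element $h_1\in HR$ is given by $h_1(0)=1$, $h_1(m)=0$ for $m\ne 0$. For $a\in R$: $(a)_{\underline{0}}=1$ and $(a)_{\underline{n}}=a(a-1)\cdots(a-n+1)$ for $n\ge1$. Set $\Omega_R=\{t\in R:(t)_{\underline{n}}\in R^\times\text{ for every }n\ge1\}$. For $t\in\Omega_R$ and $f,g\in HR$, $$(f\boxplus^H_t g)(n)=\sum_{i+j=n}\frac{(t)_{\underline{n}}}{(t)_{\underline{i}}(t)_{\underline{j}}}f(i)g(j),\qquad n\in\mathbb{N}.$$ $R[[z]]$ is the formal power series algebra with the Cauchy product, and $\Phi_t^H:HR\to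 R[[z]]$ is $\Phi_t^H(f)(z)=\sum_{n\ge0}\frac{f(n)}{(t)_{\underline{n}}}z^n$. *)

theory Defs
  imports "HOL-Computational_Algebra.Formal_Power_Series" "HOL-Library.Function_Algebras"
begin

(* The sort {comm_ring, comm_monoid_mult} is that of unital commutative rings in which
   0 = 1 is allowed; comm_ring_1 would exclude the zero ring. *)
locale rat_algebra = vector_space scale
  for scale :: "rat \<Rightarrow> 'a::{comm_ring, comm_monoid_mult} \<Rightarrow> 'a" +
  assumes scale_mult_left: "scale q x * y = scale q (x * y)"

primrec falling :: "'a::{comm_ring, comm_monoid_mult} \<Rightarrow> nat \<Rightarrow> 'a" where
  "falling a 0 = 1"
| "falling a (Suc n) = a * falling (a - 1) n"

definition Omega :: "'a::{comm_ring, comm_monoid_mult} set" where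
  "Omega = {t. \<forall>n\<ge>1. falling t n dvd 1}"

(* Meaningful only when a is a unit, where the inverse exists and is unique. *)
definition unit_inv :: "'a::comm_monoid_mult \<Rightarrow> 'a" where
  "unit_inv a = (THE b. a * b = 1)"

(* HR is the type nat => 'a; its addition is the componentwise one of Function_Algebras.
   The componentwise multiplication of that theory plays no role here. *)
definition hscale :: "'a::times \<Rightarrow> (nat \<Rightarrow> 'a) \<Rightarrow> nat \<Rightarrow> 'a" where
  "hscale c f = (\<lambda>n. c * f n)"

definition h1 :: "nat \<Rightarrow> 'a::{zero, one}" where
  "h1 = (\<lambda>n. if n = 0 then 1 else 0)"

(* The binomial coefficients act through the Q-structure: of_nat is unavailable without 0 ~= 1. *)
definition hurwitz_prod ::
  "(rat \<Rightarrow> 'a \<Rightarrow> 'a) \<Rightarrow> (nat \<Rightarrow> 'a::{comm_ring, comm_monoid_mult}) \<Rightarrow> (nat \<Rightarrow> 'a) \<Rightarrow> nat \<Rightarrow> 'a" where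
  "hurwitz_prod scale f g = (\<lambda>n. \<Sum>k=0..n. scale (of_nat (n choose k)) (f k * g (n - k)))"

definition hbox ::
  "'a \<Rightarrow> (nat \<Rightarrow> 'a::{comm_ring, comm_monoid_mult}) \<Rightarrow> (nat \<Rightarrow> 'a) \<Rightarrow> nat \<Rightarrow> 'a" where
  "hbox t f g = (\<lambda>n. \<Sum>(i, j)\<in>{(i, j). i + j = n}.
     falling t n * unit_inv (falling t i * falling t j) * f i * g j)"

definition Phi :: "'a \<Rightarrow> (nat \<Rightarrow> 'a::{comm_ring, comm_monoid_mult}) \<Rightarrow> 'a fps" where
  "Phi t f = Abs_fps (\<lambda>n. f n * unit_inv (falling t n))"

definition linear_map ::
  "('r \<Rightarrow> 'm::plus \<Rightarrow> 'm) \<Rightarrow> ('r \<Rightarrow> 'n::plus \<Rightarrow> 'n) \<Rightarrow> ('m \<Rightarrow> 'n) \<Rightarrow> bool" where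
  "linear_map s1 s2 T \<longleftrightarrow>
     (\<forall>x y. T (x + y) = T x + T y) \<and> (\<forall>c x. T (s1 c x) = s2 c (T x))"

definition bilinear_op :: "('r \<Rightarrow> 'm::plus \<Rightarrow> 'm) \<Rightarrow> ('m \<Rightarrow> 'm \<Rightarrow> 'm) \<Rightarrow> bool" where
  "bilinear_op s m \<longleftrightarrow>
     (\<forall>x. linear_map s s (m x)) \<and> (\<forall>y. linear_map s s (\<lambda>x. m x y))"

definition algebra_iso ::
  "('r \<Rightarrow> 'm::plus \<Rightarrow> 'm) \<Rightarrow> ('m \<Rightarrow> 'm \<Rightarrow> 'm) \<Rightarrow> 'm \<Rightarrow>
   ('r \<Rightarrow> 'n::plus \<Rightarrow> 'n) \<Rightarrow> ('n \<Rightarrow> 'n \<Rightarrow> 'n) \<Rightarrow> 'n \<Rightarrow> ('m \<Rightarrow> 'n) \<Rightarrow> bool" where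
  "algebra_iso s1 m1 e1 s2 m2 e2 T \<longleftrightarrow>
     linear_map s1 s2 T \<and> (\<forall>x y. T (m1 x y) = m2 (T x) (T y)) \<and> T e1 = e2 \<and> bij T"

end

theory Submission
  imports Defs
begin

text \<open>Since every falling factorial of \<open>t\<close> is a unit, \<open>Phi t\<close> merely rescales the coefficients
  by units, so it is a linear bijection, and the operation \<open>hbox t\<close> is the Cauchy product
  transported along it. At \<open>t = - 1\<close> the falling factorial is \<open>(- 1)\<^sup>n n!\<close>; in the weight
  the signs cancel and the binomial coefficient remains.\<close>

text \<open>Inverses in a commutative monoid are unique, so any explicit inverse determines the
  definite description in \<open>unit_inv\<close>.\<close>

lemma unit_inv_eqI:
  fixes a :: "'a::comm_monoid_mult"
  assumes "a * b = 1"
  shows "unit_inv a = b"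
  unfolding unit_inv_def
proof (rule the_equality)
  show "a * b = 1" by (fact assms)
next
  fix c assume c: "a * c = 1"
  have "c = (a * b) * c" by (simp add: assms)
  also have "\<dots> = b * (a * c)" by (simp add: ac_simps)
  finally show "c = b" by (simp add: c)
qed

lemma mult_unit_inv:
  fixes a :: "'a::comm_monoid_mult"
  assumes "a dvd 1"
  shows "a * unit_inv a = 1"
proof -
  from assms obtain b where "a * b = 1" by (auto simp: dvd_def)
  then show ?thesis using unit_inv_eqI by metis
qed

lemma unit_inv_mult:
  fixes a b :: "'a::comm_monoid_mult"
  assumes "a dvd 1" "b dvd 1"
  shows "unit_inv (a * b) = unit_inv a * unit_inv b"
proof (rule unit_inv_eqI)
  have "a * b * (unit_inv a * unit_inv b) = (a * unit_inv a) * (b * unit_inv b)"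
    by (simp only: ac_simps)
  then show "a * b * (unit_inv a * unit_inv b) = 1"
    using assms by (simp add: mult_unit_inv)
qed

lemma unit_inv_one [simp]: "unit_inv (1 :: 'a::comm_monoid_mult) = 1"
  by (rule unit_inv_eqI) simp

lemma falling_dvd_one:
  assumes "t \<in> Omega"
  shows "falling t n dvd 1"
  \<comment> \<open>\<open>Omega\<close> speaks only of positive indices; at index 0 the falling
    factorial is the empty product 1.\<close>
  using assms by (cases n) (auto simp: Omega_def simp del: falling.simps(2))

lemma hbox_altdef:
  "hbox t f g n =
     (\<Sum>i=0..n. falling t n * unit_inv (falling t i * falling t (n - i)) * f i * g (n - i))"
  unfolding hbox_def
  by (rule sum.reindex_bij_witness[of _ "\<lambda>i. (i, n - i)" fst]) auto

lemma Phi_nth: "fps_nth (Phi t f) n = f n * unit_inv (falling t n)"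
  by (simp add: Phi_def)

lemma Phi_hbox:
  assumes t: "t \<in> Omega"
  shows "Phi t (hbox t f g) = Phi t f * Phi t g"
proof (rule fps_ext)
  fix n
  let ?u = "falling t" and ?v = "\<lambda>n. unit_inv (falling t n)"
  have "?u n * unit_inv (?u i * ?u (n - i)) * f i * g (n - i) * ?v n
      = f i * ?v i * (g (n - i) * ?v (n - i))" for i
  proof -
    \<comment> \<open>The inverse of the product splits, and the numerator \<open>?u n\<close> of
      the weight meets the factor \<open>?v n\<close> contributed by \<open>Phi\<close>; these two
      cancel, leaving a Cauchy product term.\<close>
    have "?u n * unit_inv (?u i * ?u (n - i)) * f i * g (n - i) * ?v n
        = (?u n * ?v n) * (f i * ?v i * (g (n - i) * ?v (n - i)))"
      by (simp only: unit_inv_mult falling_dvd_one[OF t] ac_simps)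
    then show ?thesis by (simp add: mult_unit_inv falling_dvd_one[OF t])
  qed
  then show "fps_nth (Phi t (hbox t f g)) n = fps_nth (Phi t f * Phi t g) n"
    by (simp add: Phi_nth hbox_altdef fps_mult_nth sum_distrib_right)
qed

lemma bij_Phi:
  assumes t: "t \<in> Omega"
  shows "bij (Phi t)"
proof (rule bij_betw_byWitness[where f' = "\<lambda>F n. fps_nth F n * falling t n"])
  have "unit_inv (falling t n) * falling t n = 1" for n
    using mult_unit_inv[OF falling_dvd_one[OF t]] by (simp add: mult.commute)
  then show "\<forall>f\<in>UNIV. (\<lambda>n. fps_nth (Phi t f) n * falling t n) = f"
    by (simp add: Phi_nth mult.assoc)
  show "\<forall>F\<in>UNIV. Phi t (\<lambda>n. fps_nth F n * falling t n) = F"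
    by (simp add: fps_eq_iff Phi_nth mult.assoc mult_unit_inv falling_dvd_one[OF t])
qed auto

lemma linear_map_Phi: "linear_map hscale (\<lambda>c F. fps_const c * F) (Phi t)"
  by (simp add: linear_map_def fps_eq_iff Phi_nth hscale_def algebra_simps)

lemma Phi_h1: "Phi t h1 = 1"
  by (simp add: fps_eq_iff Phi_nth h1_def)

lemma linear_map_hbox_right: "linear_map hscale hscale (hbox t f)"
  by (simp add: linear_map_def fun_eq_iff hbox_altdef hscale_def algebra_simps
      sum.distrib sum_distrib_left)

lemma hbox_commute: "hbox t f g = hbox t g f"
proof
  fix n
  show "hbox t f g n = hbox t g f n"
    unfolding hbox_altdef
    by (rule sum.reindex_bij_witness[of _ "\<lambda>i. n - i" "\<lambda>i. n - i"]) (auto simp: ac_simps)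
qed

lemma bilinear_op_hbox: "bilinear_op hscale (hbox t)"
proof -
  \<comment> \<open>Commutativity reduces linearity in the left argument to linearity in the right
    one.\<close>
  have "(\<lambda>x. hbox t x y) = hbox t y" for y
    using hbox_commute by (rule ext)
  then show ?thesis by (simp add: bilinear_op_def linear_map_hbox_right)
qed

text \<open>Associativity is pulled back from power series along the injective multiplicative map
  \<open>Phi t\<close>.\<close>

lemma hbox_assoc:
  assumes t: "t \<in> Omega"
  shows "hbox t (hbox t f g) h = hbox t f (hbox t g h)"
proof (rule injD[OF bij_is_inj[OF bij_Phi[OF t]]])
  show "Phi t (hbox t (hbox t f g) h) = Phi t (hbox t f (hbox t g h))"
    by (simp add: Phi_hbox[OF t] mult.assoc)
qed

lemma hbox_h1_left:
  assumes t: "t \<in> Omega"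
  shows "hbox t h1 f = f"
proof
  fix n
  \<comment> \<open>Only i = 0 survives, and its weight is \<open>falling t n\<close> times its own
    inverse.\<close>
  have "hbox t h1 f n = (\<Sum>i=0..n. if i = 0 then f n else 0)"
    unfolding hbox_altdef
    by (rule sum.cong) (auto simp: h1_def mult_unit_inv falling_dvd_one[OF t])
  then show "hbox t h1 f n = f n" by simp
qed

text \<open>The defining recursion splits off the first factor and shifts the base, so an induction
  with base -1 fixed would not close. Splitting off the last factor keeps the base.\<close>

lemma falling_rat_Suc: "falling (a::rat) (Suc n) = falling a n * (a - of_nat n)"
proof (induction n arbitrary: a)
  case (Suc n)
  show ?case
    by (subst falling.simps(2), subst Suc.IH) (simp add: algebra_simps)
qed simp

lemma falling_rat_minus_one: "falling (- 1 :: rat) n = (- 1) ^ n * fact n"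
proof (induction n)
  case (Suc n)
  then show ?case by (simp add: falling_rat_Suc algebra_simps del: falling.simps(2))
qed simp

lemma falling_rat_minus_one_binomial:
  assumes "i \<le> n"
  shows "falling (- 1 :: rat) n * inverse (falling (- 1) i * falling (- 1) (n - i))
    = of_nat (n choose i)"
proof -
  have "(- 1 :: rat) ^ n = (- 1) ^ i * (- 1) ^ (n - i)"
    using assms by (simp flip: power_add)
  then show ?thesis
    using assms by (simp add: falling_rat_minus_one binomial_fact field_simps)
qed

context rat_algebra
begin

text \<open>Sending \<open>q\<close> to \<open>scale q 1\<close> is the ring homomorphism from the
  rationals to \<open>'a\<close>. Identities at -1 are proved in the field of rationals and carried
  over by it, which also covers the zero ring.\<close>

lemma scale_one_mult: "scale p 1 * scale q 1 = scale (p * q) 1"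
  by (simp add: scale_mult_left)

lemma unit_inv_scale_one:
  assumes "q \<noteq> 0"
  shows "unit_inv (scale q 1) = scale (inverse q) 1"
  by (rule unit_inv_eqI) (simp add: scale_one_mult assms del: scale_scale)

lemma falling_scale_one: "falling (scale q 1) n = scale (falling q n) 1"
\<comment> \<open>The recursion moves from \<open>q\<close> to \<open>q - 1\<close>, hence the
  generalisation over \<open>q\<close>.\<close>
proof (induction n arbitrary: q)
  case (Suc n)
  have "scale q 1 - 1 = scale (q - 1) 1" by (simp add: scale_left_diff_distrib)
  then show ?case by (simp add: Suc.IH scale_one_mult)
qed simp

lemma falling_minus_one: "falling (- 1 :: 'a) n = scale (falling (- 1) n) 1"
  using falling_scale_one[of "- 1" n] by simp

text \<open>Up to sign the falling factorials at -1 are factorials, nonzero in the rationals, so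
  their images in \<open>'a\<close> are units.\<close>

lemma minus_one_in_Omega: "(- 1 :: 'a) \<in> Omega"
proof -
  have "falling (- 1 :: rat) n \<noteq> 0" for n
    by (simp add: falling_rat_minus_one)
  then have "falling (- 1 :: 'a) n * scale (inverse (falling (- 1) n)) 1 = 1" for n
    by (simp add: falling_minus_one scale_one_mult del: scale_scale)
  then have "falling (- 1 :: 'a) n dvd 1" for n
    unfolding dvd_def by metis
  then show ?thesis by (simp add: Omega_def)
qed

lemma hbox_minus_one: "hbox (- 1) f g n = hurwitz_prod scale f g n"
  unfolding hbox_altdef hurwitz_prod_def
proof (rule sum.cong[OF refl])
  fix i assume "i \<in> {0..n}"
  let ?c = "falling (- 1 :: rat)"
  have nz: "?c i * ?c (n - i) \<noteq> 0" by (simp add: falling_rat_minus_one)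
  \<comment> \<open>The whole weight is the image of a rational number, so the binomial identity
    over the rationals applies.\<close>
  have "falling (- 1) n * unit_inv (falling (- 1) i * falling (- 1) (n - i))
      = scale (?c n * inverse (?c i * ?c (n - i))) 1"
    by (simp only: falling_minus_one scale_one_mult unit_inv_scale_one[OF nz])
  also have "\<dots> = scale (of_nat (n choose i)) 1"
    using \<open>i \<in> {0..n}\<close> by (simp only: falling_rat_minus_one_binomial atLeastAtMost_iff)
  finally show "falling (- 1) n * unit_inv (falling (- 1) i * falling (- 1) (n - i)) * f i * g (n - i)
      = scale (of_nat (n choose i)) (f i * g (n - i))"
    by (simp add: scale_mult_left mult.assoc)
qed

end

theorem proposition2p3:
  fixes scale :: "rat \<Rightarrow> 'a::{comm_ring, comm_monoid_mult} \<Rightarrow> 'a"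
  assumes "rat_algebra scale"
  shows "(\<forall>t \<in> (Omega :: 'a set).
            bilinear_op hscale (hbox t)
          \<and> (\<forall>f g. hbox t f g = hbox t g f)
          \<and> (\<forall>f g h. hbox t (hbox t f g) h = hbox t f (hbox t g h))
          \<and> (\<forall>f. hbox t h1 f = f \<and> hbox t f h1 = f)
          \<and> algebra_iso hscale (hbox t) h1 (\<lambda>c F. fps_const c * F) (*) 1 (Phi t)
          \<and> (\<forall>f g. Phi t (hbox t f g) = Phi t f * Phi t g))
       \<and> (- 1 :: 'a) \<in> Omega
       \<and> (\<forall>(f :: nat \<Rightarrow> 'a) g n. hbox (- 1) f g n = hurwitz_prod scale f g n)"
proof -
  interpret rat_algebra scale by fact
  show ?thesis
    using minus_one_in_Omega hbox_minus_one
    by (auto simp: algebra_iso_def bilinear_op_hbox hbox_assoc hbox_h1_left linear_map_Phi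
        Phi_hbox Phi_h1 bij_Phi hbox_commute[of _ _ h1] intro: hbox_commute)
qed

end
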